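(* Let $p$ be a prime such that $\mathcal{H}^1(X_0^+(p))$ has a good basis. Then $\mathcal{W}_p(z)\in S_{g(g+1)}(p)$ has $p$-integral rational coefficients.
   Context: $X_0^+(p)$ is the quotient of the modular curve $X_0(p)$ by the Atkin--Lehner involution $w_p$, $g\ge 2$ is its genus, and $S_2^+(p)$ is the space of $w_p$-invariant weight 2 cusp forms on $\Gamma_0(p)$ (dimension $g$). $\mathcal{W}_p(z)$ is the scalar multiple, normalized to have leading Fourier coefficient 1, of the Wronskian $W(H_1,\dots,H_g)=\det(H_j^{(i-1)})_{1\le i,j\le g}$ (derivatives in $z$) of any basis $H_1,\dots,H_g$ of $S_2^+(p)$; it is independent of the basis. $\mathcal{H}^1(X_0^+(p))$ has a good basis if the unique basis $f_1,\dots,f_g$ of $S_2^+(p)$ with rational coefficients of the form $f_i=q^{c_i}+O(q^{c_g+1})$, $c_1<\dots<c_g$, has $p$-integral Fourier coefficients. *)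

theory Defs
  imports
    "HOL-Complex_Analysis.Complex_Analysis"
    "HOL-Computational_Algebra.Primes"
    "HOL-Library.Function_Algebras"
    "Jordan_Normal_Form.Determinant"
begin

definition uhp :: "complex set" where
  "uhp = {z. Im z > 0}"

text \<open>
  The weight k slash action of the integer matrix with rows (a, b) and (c, d), normalised with the
  factor \<open>det ^ (k - 1)\<close>. In weight 2 this is the pullback of the differential \<open>f(z) dz\<close>.
\<close>

definition slash ::
  "int \<Rightarrow> int \<Rightarrow> int \<Rightarrow> int \<Rightarrow> int \<Rightarrow> (complex \<Rightarrow> complex) \<Rightarrow> complex \<Rightarrow> complex" where
  "slash k a b c d f z =
     of_int (a * d - b * c) powi (k - 1) * (of_int c * z + of_int d) powi (- k) *
     f ((of_int a * z + of_int b) / (of_int c * z + of_int d))"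

text \<open>
  \<open>f(z) = \<Sum>n. \<alpha>(n) exp(2 \<pi> i n z / h)\<close> on the upper half plane. The sequence \<open>\<alpha>\<close> is determined by f
  and h, so it is legitimate to speak about the coefficients through an existential quantifier.
\<close>

definition has_fourier_expansion ::
  "nat \<Rightarrow> (complex \<Rightarrow> complex) \<Rightarrow> (nat \<Rightarrow> complex) \<Rightarrow> bool" where
  "has_fourier_expansion h f \<alpha> \<longleftrightarrow>
     (\<forall>z\<in>uhp. (\<lambda>n. \<alpha> n * exp (2 * of_real pi * \<i> * of_nat n * z / of_nat h)) sums f z)"

abbreviation has_q_expansion :: "(complex \<Rightarrow> complex) \<Rightarrow> (nat \<Rightarrow> complex) \<Rightarrow> bool" where
  "has_q_expansion \<equiv> has_fourier_expansion 1"

text \<open>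
  The space \<open>S\<^sub>k(\<Gamma>\<^sub>0(N))\<close>. Functions on the upper half plane are represented by functions on the
  complex numbers that are 0 elsewhere, so that equality of functions and linear algebra are
  the intended ones. Vanishing at the cusps is required of all \<open>SL\<^sub>2(\<int>)\<close>-translates, each of
  which is invariant under \<open>\<Gamma>(N)\<close> and hence has period N.
\<close>

definition cusp_forms :: "nat \<Rightarrow> int \<Rightarrow> (complex \<Rightarrow> complex) set" where
  "cusp_forms N k = {f.
     f holomorphic_on uhp \<and>
     (\<forall>z. z \<notin> uhp \<longrightarrow> f z = 0) \<and>
     (\<forall>a b c d. a * d - b * c = 1 \<and> int N dvd c \<longrightarrow> (\<forall>z\<in>uhp. slash k a b c d f z = f z)) \<and>
     (\<forall>a b c d. a * d - b * c = 1 \<longrightarrow>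
        (\<exists>\<alpha>. has_fourier_expansion N (slash k a b c d f) \<alpha> \<and> \<alpha> 0 = 0))}"

text \<open>
  The Atkin--Lehner involution \<open>w\<^sub>p\<close> is given by the matrix with rows \<open>(0, -1)\<close> and \<open>(p, 0)\<close>.
\<close>

definition S2_plus :: "nat \<Rightarrow> (complex \<Rightarrow> complex) set" where
  "S2_plus p = {f \<in> cusp_forms p 2. \<forall>z\<in>uhp. slash 2 0 (-1) (int p) 0 f z = f z}"

global_interpretation cfun: vector_space "\<lambda>(c::complex) (f::complex \<Rightarrow> complex) z. c * f z"
  by unfold_locales (auto simp: fun_eq_iff algebra_simps)

text \<open>
  The genus of \<open>X\<^sub>0\<^sup>+(p)\<close>, as the dimension of its space of holomorphic differentials: these are the
  \<open>f(z) dz\<close> with f in \<open>S\<^sub>2\<^sup>+(p)\<close>.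
\<close>

definition genus_X0_plus :: "nat \<Rightarrow> nat" where
  "genus_X0_plus p = cfun.dim (S2_plus p)"

text \<open>Families are indexed from 0, so \<open>f 0, \<dots>, f (g - 1)\<close> stands for \<open>f\<^sub>1, \<dots>, f\<^sub>g\<close>.\<close>

definition is_basis_S2_plus :: "nat \<Rightarrow> (nat \<Rightarrow> complex \<Rightarrow> complex) \<Rightarrow> bool" where
  "is_basis_S2_plus p f \<longleftrightarrow> (let I = {..<genus_X0_plus p} in
     inj_on f I \<and> cfun.independent (f ` I) \<and> cfun.span (f ` I) = S2_plus p)"

text \<open>\<open>\<alpha> i n\<close> is the n-th Fourier coefficient of \<open>f i\<close>.\<close>

definition is_reduced_basis ::
  "nat \<Rightarrow> (nat \<Rightarrow> nat) \<Rightarrow> (nat \<Rightarrow> complex \<Rightarrow> complex) \<Rightarrow> (nat \<Rightarrow> nat \<Rightarrow> complex) \<Rightarrow> bool" where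
  "is_reduced_basis p c f \<alpha> \<longleftrightarrow> (let g = genus_X0_plus p in
     is_basis_S2_plus p f \<and>
     strict_mono_on {..<g} c \<and>
     (\<forall>i<g. has_q_expansion (f i) (\<alpha> i) \<and>
            (\<forall>n. \<alpha> i n \<in> \<rat>) \<and>
            (\<forall>n\<le>c (g - 1). \<alpha> i n = (if n = c i then 1 else 0))))"

definition p_integral :: "nat \<Rightarrow> complex \<Rightarrow> bool" where
  "p_integral p x \<longleftrightarrow> (\<exists>a b::int. \<not> int p dvd b \<and> x = of_int a / of_int b)"

text \<open>A reduced basis is unique, being in reduced echelon form.\<close>

definition has_good_basis :: "nat \<Rightarrow> bool" where
  "has_good_basis p \<longleftrightarrow>
     (\<exists>c f \<alpha>. is_reduced_basis p c f \<alpha> \<and> (\<forall>i<genus_X0_plus p. \<forall>n. p_integral p (\<alpha> i n)))"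

definition wronskian :: "nat \<Rightarrow> (nat \<Rightarrow> complex \<Rightarrow> complex) \<Rightarrow> complex \<Rightarrow> complex" where
  "wronskian g H z =
     (if z \<in> uhp then Determinant.det (mat g g (\<lambda>(i, j). (deriv ^^ i) (H j) z)) else 0)"

definition has_leading_coeff_1 :: "(complex \<Rightarrow> complex) \<Rightarrow> bool" where
  "has_leading_coeff_1 f \<longleftrightarrow>
     (\<exists>\<alpha> n. has_q_expansion f \<alpha> \<and> \<alpha> n = 1 \<and> (\<forall>m<n. \<alpha> m = 0))"

text \<open>
  The definite description makes sense because the Wronskians of two bases differ by a nonzero
  constant factor, the determinant of the base change.
\<close>

definition normalized_wronskian :: "nat \<Rightarrow> complex \<Rightarrow> complex" where
  "normalized_wronskian p = (THE W. has_leading_coeff_1 W \<and>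
     (\<exists>H s. is_basis_S2_plus p H \<and> W = (\<lambda>z. s * wronskian (genus_X0_plus p) H z)))"

end

theory Submission
  imports Defs "HOL-Analysis.Kronecker_Approximation_Theorem"
begin

text \<open>
  On q-expansions the derivative is \<open>2 \<pi> i \<theta>\<close> with \<open>\<theta> = q d/dq\<close>, so up to a constant the Wronskian of the
  good basis is \<open>det (\<theta>\<^sup>i f\<^sub>j)\<close>, which has p-integral coefficients and whose leading coefficient is the
  Vandermonde determinant \<open>V = \<Prod>l<i. (c\<^sub>i - c\<^sub>l)\<close>. Dividing by V preserves p-integrality
  because \<open>c\<^sub>g < p\<close>: a form in \<open>S\<^sub>2\<^sup>+(p)\<close> that vanishes to order p at the cusp is 0. The latter
  is a weak form of Sturm's bound and is obtained from the maximum principle, using that the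
  group generated by \<open>\<Gamma>\<^sub>0(p)\<close> and \<open>w\<^sub>p\<close> moves every point to height at least \<open>2 / (5 p)\<close>.
\<close>

section \<open>Determinants\<close>

lemma det_mat_lower_mult:
  fixes L B :: "nat \<Rightarrow> nat \<Rightarrow> 'a :: idom"
  assumes "\<And>i j. i < n \<Longrightarrow> j < n \<Longrightarrow> A i j = (\<Sum>l\<le>i. L i l * B l j)"
  shows "Determinant.det (mat n n (\<lambda>(i, j). A i j)) =
    (\<Prod>i<n. L i i) * Determinant.det (mat n n (\<lambda>(i, j). B i j))"
proof -
  let ?L = "mat n n (\<lambda>(i, j). if j \<le> i then L i j else 0)"
  let ?B = "mat n n (\<lambda>(i, j). B i j)"
  have "mat n n (\<lambda>(i, j). A i j) = ?L * ?B"
  proof (rule eq_matI)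
    fix i j assume "i < dim_row (?L * ?B)" "j < dim_col (?L * ?B)"
    hence ij: "i < n" "j < n" by auto
    have "(\<Sum>l\<le>i. L i l * B l j) = (\<Sum>l<n. (if l \<le> i then L i l else 0) * B l j)"
      using ij by (intro sum.mono_neutral_cong_left) auto
    thus "mat n n (\<lambda>(i, j). A i j) $$ (i, j) = (?L * ?B) $$ (i, j)"
      using ij assms by (simp add: scalar_prod_def lessThan_atLeast0)
  qed auto
  moreover have "Determinant.det ?L = (\<Prod>i<n. L i i)"
    by (subst det_lower_triangular[of n]) (auto simp: prod_list_diag_prod lessThan_atLeast0)
  ultimately show ?thesis
    by (simp add: det_mult[of _ n])
qed

lemma det_mat_eq_sum:
  "Determinant.det (mat n n (\<lambda>(i, j). A i j)) =
    (\<Sum>\<pi> | \<pi> permutes {..<n}. signof \<pi> * (\<Prod>i<n. A i (\<pi> i)))"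
proof -
  have "\<pi> i < n" if "\<pi> permutes {..<n}" "i < n" for \<pi> i
    using permutes_in_image[OF that(1)] that(2) by simp
  thus ?thesis
    unfolding det_def'[OF mat_carrier] lessThan_atLeast0[symmetric]
    by (intro sum.cong refl arg_cong2[of _ _ _ _ "(*)"] prod.cong) auto
qed

lemma det_mat_col_scale:
  fixes B :: "nat \<Rightarrow> nat \<Rightarrow> 'a :: comm_ring_1"
  shows "Determinant.det (mat n n (\<lambda>(i, j). B i j * u j)) =
    (\<Prod>j<n. u j) * Determinant.det (mat n n (\<lambda>(i, j). B i j))"
proof -
  have "(\<Prod>i<n. B i (\<pi> i) * u (\<pi> i)) = (\<Prod>j<n. u j) * (\<Prod>i<n. B i (\<pi> i))"
    if "\<pi> permutes {..<n}" for \<pi>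
    using prod.permute[OF that, of u] by (simp add: prod.distrib o_def mult.commute)
  thus ?thesis
    unfolding det_mat_eq_sum sum_distrib_left
    by (intro sum.cong refl) (simp add: mult_ac)
qed

text \<open>
  The Newton polynomials \<open>\<Prod>l<i. (X - x l)\<close> are related to the monomials by a unitriangular
  matrix, and their values at the nodes form a triangular matrix.
\<close>

lemma det_Vandermonde:
  fixes x :: "nat \<Rightarrow> 'a :: idom"
  shows "Determinant.det (mat n n (\<lambda>(i, j). x j ^ i)) = (\<Prod>i<n. \<Prod>l<i. x i - x l)"
proof -
  define P where "P i = (\<Prod>l<i. [:- x l, 1:])" for i
  have deg: "degree (P i) = i" for i
    unfolding P_def by (subst degree_prod_eq_sum_degree) auto
  have "lead_coeff (P i) = 1" for i
    unfolding P_def by (simp add: lead_coeff_prod)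
  hence lead: "coeff (P i) i = 1" for i
    using deg[of i] by metis
  have eval: "poly (P i) y = (\<Prod>l<i. y - x l)" for i y
    by (simp add: P_def poly_prod)
  have "Determinant.det (mat n n (\<lambda>(i, j). poly (P i) (x j))) =
    (\<Prod>i<n. coeff (P i) i) * Determinant.det (mat n n (\<lambda>(i, j). x j ^ i))"
    by (rule det_mat_lower_mult) (simp add: poly_altdef deg)
  moreover have "poly (P i) (x j) = 0" if "j < i" for i j
    unfolding eval using that by (intro prod_zero) auto
  hence "Determinant.det (mat n n (\<lambda>(i, j). poly (P i) (x j))) = (\<Prod>i<n. poly (P i) (x i))"
    by (subst det_upper_triangular[of _ n])
       (auto simp: upper_triangular_def prod_list_diag_prod lessThan_atLeast0)
  ultimately show ?thesis
    by (simp add: lead eval)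
qed

section \<open>p-integrality\<close>

lemma p_integral_of_int: "prime p \<Longrightarrow> p_integral p (of_int m)"
  unfolding p_integral_def by (rule exI[of _ m], rule exI[of _ 1]) (auto simp: prime_nat_iff)

lemma p_integral_add:
  assumes "prime p" "p_integral p x" "p_integral p y"
  shows "p_integral p (x + y)"
proof -
  obtain a b c d :: int where *: "\<not> int p dvd b" "\<not> int p dvd d"
    "x = of_int a / of_int b" "y = of_int c / of_int d"
    using assms(2,3) unfolding p_integral_def by blast
  have "b \<noteq> 0" "d \<noteq> 0"
    using * by auto
  hence "x + y = of_int (a * d + c * b) / of_int (b * d)"
    by (simp add: * field_simps)
  moreover have "\<not> int p dvd b * d"
    using * assms(1) by (simp add: prime_dvd_mult_iff)
  ultimately show ?thesis
    unfolding p_integral_def by blast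
qed

lemma p_integral_mult:
  assumes "prime p" "p_integral p x" "p_integral p y"
  shows "p_integral p (x * y)"
proof -
  obtain a b c d :: int where *: "\<not> int p dvd b" "\<not> int p dvd d"
    "x = of_int a / of_int b" "y = of_int c / of_int d"
    using assms(2,3) unfolding p_integral_def by blast
  have "x * y = of_int (a * c) / of_int (b * d)"
    by (simp add: *)
  moreover have "\<not> int p dvd b * d"
    using * assms(1) by (simp add: prime_dvd_mult_iff)
  ultimately show ?thesis
    unfolding p_integral_def by blast
qed

lemma p_integral_sum:
  assumes "prime p" "\<And>x. x \<in> A \<Longrightarrow> p_integral p (f x)"
  shows "p_integral p (sum f A)"
  using assms(2)
  by (induction A rule: infinite_finite_induct)
     (use p_integral_of_int[OF assms(1), of 0] in \<open>auto intro: p_integral_add assms(1)\<close>)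

lemma p_integral_fps_mult:
  assumes "prime p" "\<And>n. p_integral p (fps_nth F n)" "\<And>n. p_integral p (fps_nth G n)"
  shows "p_integral p (fps_nth (F * G) n)"
  unfolding fps_mult_nth by (intro p_integral_sum p_integral_mult assms)

lemma p_integral_fps_prod:
  assumes "prime p" "\<And>x n. x \<in> A \<Longrightarrow> p_integral p (fps_nth (F x) n)"
  shows "p_integral p (fps_nth (\<Prod>x\<in>A. F x) n)"
proof -
  have "p_integral p (fps_nth 1 n)" for n
    using p_integral_of_int[OF assms(1), of "if n = 0 then 1 else 0"] by (simp split: if_splits)
  thus ?thesis
    using assms(2)
    by (induction A arbitrary: n rule: infinite_finite_induct) (auto intro: p_integral_fps_mult assms(1))
qed

lemma p_integral_fps_det:
  assumes "prime p" "\<And>i j m. i < n \<Longrightarrow> j < n \<Longrightarrow> p_integral p (fps_nth (A i j) m)"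
  shows "p_integral p (fps_nth (Determinant.det (mat n n (\<lambda>(i, j). A i j))) m)"
proof -
  have *: "\<pi> i < n" if "\<pi> permutes {..<n}" "i < n" for \<pi> i
    using permutes_in_image[OF that(1)] that(2) by simp
  have sgn: "p_integral p (fps_nth (signof \<pi>) m)" for \<pi> :: "nat \<Rightarrow> nat" and m
    using p_integral_of_int[OF assms(1), of "if m = 0 then sign \<pi> else 0"]
    by (auto simp: sign_def split: if_splits)
  show ?thesis
    unfolding det_mat_eq_sum fps_sum_nth
    by (intro p_integral_sum p_integral_fps_mult p_integral_fps_prod assms(1) sgn)
       (auto intro: assms(2) *)
qed

section \<open>Fourier expansions\<close>

text \<open>
  Fourier expansions as convergent formal power series in \<open>exp (2 \<pi> i z / h)\<close>, so that they can
  be added, multiplied and differentiated formally.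
\<close>

definition nome :: "nat \<Rightarrow> complex \<Rightarrow> complex" where
  "nome h z = exp (2 * of_real pi * \<i> * z / of_nat h)"

definition has_fps_fourier :: "nat \<Rightarrow> (complex \<Rightarrow> complex) \<Rightarrow> complex fps \<Rightarrow> bool" where
  "has_fps_fourier h f F \<longleftrightarrow>
     fps_conv_radius F \<ge> 1 \<and> (\<forall>z\<in>uhp. f z = eval_fps F (nome h z))"

lemma open_uhp: "open uhp"
  unfolding uhp_def by (rule open_halfspace_Im_gt)

lemma norm_nome: "norm (nome h z) = exp (- 2 * pi * Im z / real h)"
  by (simp add: nome_def Re_divide_of_nat)

lemma norm_nome_less_1: "h > 0 \<Longrightarrow> z \<in> uhp \<Longrightarrow> norm (nome h z) < 1"
  by (simp add: norm_nome uhp_def)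

lemma nome_surj:
  assumes "h > 0" "w \<noteq> 0" "norm w < 1"
  obtains z where "z \<in> uhp" "nome h z = w"
proof -
  define z where "z = of_nat h * Ln w / (2 * of_real pi * \<i>)"
  have "z = of_real (real h / (2 * pi)) * (- \<i> * Ln w)"
    by (simp add: z_def field_simps)
  hence "Im z = real h / (2 * pi) * (- ln (norm w))"
    using assms(2) by (simp del: Im_divide_of_nat)
  moreover have "ln (norm w) < 0"
    using assms by simp
  ultimately have "z \<in> uhp"
    using assms(1) by (simp add: uhp_def divide_neg_pos mult_pos_neg)
  moreover have "nome h z = w"
    using assms by (simp add: nome_def z_def)
  ultimately show thesis
    by (rule that)
qed

lemma has_fourier_expansion_iff:
  assumes "h > 0"
  shows "has_fourier_expansion h f \<alpha> \<longleftrightarrow> has_fps_fourier h f (Abs_fps \<alpha>)"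
proof -
  have term_eq: "exp (2 * of_real pi * \<i> * of_nat n * z / of_nat h) = nome h z ^ n" for n z
    unfolding nome_def exp_of_nat_mult[symmetric] by (simp add: mult_ac)
  have radius: "fps_conv_radius (Abs_fps \<alpha>) \<ge> 1" if "has_fourier_expansion h f \<alpha>"
    unfolding fps_conv_radius_def
  proof (rule conv_radius_geI_ex')
    fix r :: real assume "0 < r" "ereal r < 1"
    then obtain z where "z \<in> uhp" "nome h z = of_real r"
      using nome_surj[OF assms, of "of_real r"] by auto
    thus "summable (\<lambda>n. fps_nth (Abs_fps \<alpha>) n * of_real r ^ n)"
      using that unfolding has_fourier_expansion_def term_eq by (auto simp: sums_iff)
  qed
  have "(\<lambda>n. \<alpha> n * nome h z ^ n) sums eval_fps (Abs_fps \<alpha>) (nome h z)"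
    if "fps_conv_radius (Abs_fps \<alpha>) \<ge> 1" "z \<in> uhp" for z
    using sums_eval_fps[of "nome h z" "Abs_fps \<alpha>"] norm_nome_less_1[OF assms that(2)] that(1)
    by (simp add: less_le_trans[of _ 1])
  thus ?thesis
    using radius unfolding has_fourier_expansion_def has_fps_fourier_def term_eq
    by (metis sums_unique2)
qed

context
  fixes h :: nat
  assumes h: "h > 0"
begin

lemma nome_in_disc: "fps_conv_radius F \<ge> 1 \<Longrightarrow> z \<in> uhp \<Longrightarrow> ereal (norm (nome h z)) < fps_conv_radius F"
  using norm_nome_less_1[OF h, of z] by (simp add: less_le_trans[of _ 1])

lemma has_fps_fourier_add:
  assumes "has_fps_fourier h f F" "has_fps_fourier h g G"
  shows "has_fps_fourier h (\<lambda>z. f z + g z) (F + G)"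
proof -
  have "fps_conv_radius (F + G) \<ge> 1"
    using assms fps_conv_radius_add[of F G] unfolding has_fps_fourier_def
    by (auto simp: min_def split: if_splits)
  thus ?thesis
    using assms eval_fps_add[OF nome_in_disc nome_in_disc, of F _ G] by (simp add: has_fps_fourier_def)
qed

lemma has_fps_fourier_mult:
  assumes "has_fps_fourier h f F" "has_fps_fourier h g G"
  shows "has_fps_fourier h (\<lambda>z. f z * g z) (F * G)"
proof -
  have "fps_conv_radius (F * G) \<ge> 1"
    using assms fps_conv_radius_mult[of F G] unfolding has_fps_fourier_def
    by (auto simp: min_def split: if_splits)
  thus ?thesis
    using assms eval_fps_mult[OF nome_in_disc nome_in_disc, of F _ G] by (simp add: has_fps_fourier_def)
qed

lemma has_fps_fourier_const: "has_fps_fourier h (\<lambda>_. c) (fps_const c)"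
  by (simp add: has_fps_fourier_def)

lemma has_fps_fourier_cmult:
  assumes "has_fps_fourier h f F"
  shows "has_fps_fourier h (\<lambda>z. c * f z) (fps_const c * F)"
  using has_fps_fourier_mult[OF has_fps_fourier_const assms] .

lemma has_fps_fourier_sum:
  assumes "\<And>x. x \<in> A \<Longrightarrow> has_fps_fourier h (f x) (F x)"
  shows "has_fps_fourier h (\<lambda>z. \<Sum>x\<in>A. f x z) (\<Sum>x\<in>A. F x)"
  using assms
  by (induction A rule: infinite_finite_induct)
     (use has_fps_fourier_const[of 0] in \<open>auto intro: has_fps_fourier_add\<close>)

lemma has_fps_fourier_prod:
  assumes "\<And>x. x \<in> A \<Longrightarrow> has_fps_fourier h (f x) (F x)"
  shows "has_fps_fourier h (\<lambda>z. \<Prod>x\<in>A. f x z) (\<Prod>x\<in>A. F x)"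
  using assms
  by (induction A rule: infinite_finite_induct)
     (use has_fps_fourier_const[of 1] in \<open>auto intro: has_fps_fourier_mult\<close>)

lemma has_fps_fourier_det:
  assumes "\<And>i j. i < n \<Longrightarrow> j < n \<Longrightarrow> has_fps_fourier h (\<lambda>z. a z i j) (A i j)"
  shows "has_fps_fourier h (\<lambda>z. Determinant.det (mat n n (\<lambda>(i, j). a z i j)))
    (Determinant.det (mat n n (\<lambda>(i, j). A i j)))"
proof -
  have *: "\<pi> i < n" if "\<pi> permutes {..<n}" "i < n" for \<pi> i
    using permutes_in_image[OF that(1)] that(2) by simp
  have sgn: "has_fps_fourier h (\<lambda>_. signof \<pi>) (signof \<pi>)" for \<pi> :: "nat \<Rightarrow> nat"
    using has_fps_fourier_const[of "signof \<pi>"] by (simp add: fps_of_int)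
  show ?thesis
    unfolding det_mat_eq_sum
    by (intro has_fps_fourier_sum has_fps_fourier_mult has_fps_fourier_prod sgn)
       (auto intro: assms *)
qed

lemma has_field_derivative_nome: "(nome h has_field_derivative 2 * of_real pi * \<i> / of_nat h * nome h z) (at z)"
  unfolding nome_def by (use h in \<open>auto intro!: derivative_eq_intros\<close>)

lemma has_fps_fourier_has_derivative:
  assumes "has_fps_fourier h f F" "z \<in> uhp"
  shows "(f has_field_derivative
    2 * of_real pi * \<i> / of_nat h * (nome h z * eval_fps (fps_deriv F) (nome h z))) (at z)"
proof -
  have "((\<lambda>z. eval_fps F (nome h z)) has_field_derivative
      eval_fps (fps_deriv F) (nome h z) * (2 * of_real pi * \<i> / of_nat h * nome h z)) (at z)"
    using assms nome_in_disc[of F] unfolding has_fps_fourier_def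
    by (intro DERIV_chain2[where f = "eval_fps F", OF has_field_derivative_eval_fps
          has_field_derivative_nome]) auto
  hence "(f has_field_derivative
      eval_fps (fps_deriv F) (nome h z) * (2 * of_real pi * \<i> / of_nat h * nome h z)) (at z)"
    by (rule has_field_derivative_transform_within_open[OF _ open_uhp assms(2)])
       (use assms in \<open>auto simp: has_fps_fourier_def\<close>)
  thus ?thesis by (simp add: mult_ac)
qed

lemma has_fps_fourier_deriv:
  assumes "has_fps_fourier h f F"
  shows "has_fps_fourier h (deriv f)
    (Abs_fps (\<lambda>n. 2 * of_real pi * \<i> / of_nat h * of_nat n * fps_nth F n))"
proof -
  have radius: "fps_conv_radius (fps_deriv F) \<ge> 1"
    using assms fps_conv_radius_deriv[of F] unfolding has_fps_fourier_def by (meson order_trans)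
  hence radius': "fps_conv_radius (fps_X * fps_deriv F) \<ge> 1"
    using fps_conv_radius_mult[of fps_X "fps_deriv F"] by simp
  have "has_fps_fourier h (\<lambda>z. nome h z * eval_fps (fps_deriv F) (nome h z)) (fps_X * fps_deriv F)"
    using radius radius' eval_fps_mult[OF _ nome_in_disc, of _ fps_X "fps_deriv F"]
    by (simp add: has_fps_fourier_def)
  from has_fps_fourier_cmult[OF this, of "2 * of_real pi * \<i> / of_nat h"]
  have "has_fps_fourier h (deriv f) (fps_const (2 * of_real pi * \<i> / of_nat h) * (fps_X * fps_deriv F))"
    using DERIV_imp_deriv[OF has_fps_fourier_has_derivative[OF assms]]
    by (simp add: has_fps_fourier_def)
  also have "fps_const (2 * of_real pi * \<i> / of_nat h) * (fps_X * fps_deriv F) =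
      Abs_fps (\<lambda>n. 2 * of_real pi * \<i> / of_nat h * of_nat n * fps_nth F n)"
  proof (rule fps_ext)
    fix n
    show "fps_nth (fps_const (2 * of_real pi * \<i> / of_nat h) * (fps_X * fps_deriv F)) n =
      fps_nth (Abs_fps (\<lambda>n. 2 * of_real pi * \<i> / of_nat h * of_nat n * fps_nth F n)) n"
      by (cases n) (simp_all del: of_nat_Suc)
  qed
  finally show ?thesis .
qed

lemma has_fps_fourier_higher_deriv:
  assumes "has_fps_fourier h f F"
  shows "has_fps_fourier h ((deriv ^^ i) f)
    (Abs_fps (\<lambda>n. (2 * of_real pi * \<i> / of_nat h * of_nat n) ^ i * fps_nth F n))"
proof (induction i)
  case 0
  thus ?case using assms by (simp add: fps_nth_inverse)
next
  case (Suc i)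
  from has_fps_fourier_deriv[OF this] show ?case by (simp add: mult_ac)
qed

lemma has_fps_fourier_unique:
  assumes "has_fps_fourier h f F" "has_fps_fourier h f G"
  shows "F = G"
proof -
  have r: "fps_conv_radius F \<ge> 1" "fps_conv_radius G \<ge> 1"
    using assms by (auto simp: has_fps_fourier_def)
  hence r0: "fps_conv_radius F > 0" "fps_conv_radius G > 0"
    by (auto intro: less_le_trans[of 0 1])
  have eq: "eval_fps F w = eval_fps G w" if "w \<noteq> 0" "norm w < 1" for w
    using nome_surj[OF h that] assms by (metis has_fps_fourier_def)
  have ev: "eventually (\<lambda>w. norm w < (1 :: real)) (nhds (0 :: complex))"
    using eventually_nhds_in_open[of "ball 0 1" "0 :: complex"] by simp
  have lim: "(eval_fps F \<longlongrightarrow> eval_fps F 0) (at 0)" "(eval_fps G \<longlongrightarrow> eval_fps G 0) (at 0)"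
    using continuous_eval_fps[of 0 F UNIV] continuous_eval_fps[of 0 G UNIV] r0
    by (auto simp: continuous_within zero_ereal_def)
  have "eventually (\<lambda>w. eval_fps F w = eval_fps G w) (at 0)"
    using ev by (auto simp: eventually_at_filter eq elim!: eventually_mono)
  with lim(1) have "(eval_fps G \<longlongrightarrow> eval_fps F 0) (at 0)"
    by (rule Lim_transform_eventually)
  hence "eval_fps F 0 = eval_fps G 0"
    using lim(2) tendsto_unique by force
  hence "eval_fps F w = eval_fps G w" if "norm w < 1" for w
    using that eq[of w] by (cases "w = 0") auto
  hence "eventually (\<lambda>w. eval_fps F w = eval_fps G w) (nhds 0)"
    using ev by (rule eventually_mono[rotated])
  thus ?thesis
    using eval_fps_eqD r0 by blast
qed

end

section \<open>Wronskians and changes of variable\<close>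

text \<open>
  Coefficients of the derivatives of \<open>\<psi> z * f (\<phi> z)\<close>, where \<open>\<psi>\<close> is the derivative of \<open>\<phi>\<close>,
  with respect to the derivatives of f at \<open>\<phi> z\<close>.
\<close>

primrec pullback_coeff :: "(complex \<Rightarrow> complex) \<Rightarrow> nat \<Rightarrow> nat \<Rightarrow> complex \<Rightarrow> complex" where
  "pullback_coeff \<psi> 0 = (\<lambda>l z. if l = 0 then \<psi> z else 0)"
| "pullback_coeff \<psi> (Suc i) = (\<lambda>l z. deriv (pullback_coeff \<psi> i l) z +
     (if l = 0 then 0 else pullback_coeff \<psi> i (l - 1) z * \<psi> z))"

lemma pullback_coeff_holomorphic:
  assumes "open S" "\<psi> holomorphic_on S"
  shows "pullback_coeff \<psi> i l holomorphic_on S"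
proof (induction i arbitrary: l)
  case 0
  show ?case using assms by (cases "l = 0") auto
next
  case (Suc i)
  show ?case
    using Suc assms by (cases "l = 0") (auto intro!: holomorphic_intros)
qed

lemma pullback_coeff_upper: "i < l \<Longrightarrow> pullback_coeff \<psi> i l = (\<lambda>_. 0)"
proof (induction i arbitrary: l)
  case 0
  thus ?case by simp
next
  case (Suc i)
  hence "pullback_coeff \<psi> i l = (\<lambda>_. 0)" "pullback_coeff \<psi> i (l - 1) = (\<lambda>_. 0)"
    by (auto simp del: One_nat_def)
  thus ?case using Suc.prems by (simp del: One_nat_def)
qed

lemma pullback_coeff_diag: "pullback_coeff \<psi> i i z = \<psi> z ^ Suc i"
  by (induction i) (auto simp: pullback_coeff_upper)

lemma higher_deriv_pullback:
  assumes "open S" "open T" "\<phi> ` S \<subseteq> T" "\<psi> holomorphic_on S" "f holomorphic_on T"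
    and deriv: "\<And>z. z \<in> S \<Longrightarrow> (\<phi> has_field_derivative \<psi> z) (at z)"
    and "z \<in> S"
  shows "(deriv ^^ i) (\<lambda>z. \<psi> z * f (\<phi> z)) z =
    (\<Sum>l\<le>i. pullback_coeff \<psi> i l z * (deriv ^^ l) f (\<phi> z))"
  using \<open>z \<in> S\<close>
proof (induction i arbitrary: z)
  case 0
  thus ?case by simp
next
  case (Suc i)
  let ?c = "pullback_coeff \<psi> i"
  have c: "(?c l has_field_derivative deriv (?c l) z) (at z)" for l
    using pullback_coeff_holomorphic[OF assms(1,4)] assms(1) Suc.prems by (rule holomorphic_derivI)
  have f: "((\<lambda>z. (deriv ^^ l) f (\<phi> z)) has_field_derivative
      (deriv ^^ Suc l) f (\<phi> z) * \<psi> z) (at z)" for l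
    using has_field_derivative_higher_deriv[OF assms(5,2), of "\<phi> z" l] assms(3) Suc.prems
    by (intro DERIV_chain2[where f = "(deriv ^^ l) f" and g = \<phi>] deriv) auto
  have "((\<lambda>z. \<Sum>l\<le>i. ?c l z * (deriv ^^ l) f (\<phi> z)) has_field_derivative
      (\<Sum>l\<le>i. deriv (?c l) z * (deriv ^^ l) f (\<phi> z) +
        (deriv ^^ Suc l) f (\<phi> z) * \<psi> z * ?c l z)) (at z)"
    by (intro DERIV_sum DERIV_mult c f)
  hence "((deriv ^^ i) (\<lambda>z. \<psi> z * f (\<phi> z)) has_field_derivative
      (\<Sum>l\<le>i. deriv (?c l) z * (deriv ^^ l) f (\<phi> z) +
        (deriv ^^ Suc l) f (\<phi> z) * \<psi> z * ?c l z)) (at z)"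
    by (rule has_field_derivative_transform_within_open[OF _ assms(1) Suc.prems])
       (simp add: Suc.IH)
  hence "(deriv ^^ Suc i) (\<lambda>z. \<psi> z * f (\<phi> z)) z =
      (\<Sum>l\<le>i. deriv (?c l) z * (deriv ^^ l) f (\<phi> z)) +
      (\<Sum>l\<le>i. ?c l z * \<psi> z * (deriv ^^ Suc l) f (\<phi> z))"
    by (simp add: DERIV_imp_deriv sum.distrib mult_ac)
  also have "(\<Sum>l\<le>i. deriv (?c l) z * (deriv ^^ l) f (\<phi> z)) =
      (\<Sum>l\<le>Suc i. deriv (?c l) z * (deriv ^^ l) f (\<phi> z))"
    by (simp add: pullback_coeff_upper)
  also have "(\<Sum>l\<le>i. ?c l z * \<psi> z * (deriv ^^ Suc l) f (\<phi> z)) =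
      (\<Sum>l\<le>Suc i. (if l = 0 then 0 else ?c (l - 1) z * \<psi> z) * (deriv ^^ l) f (\<phi> z))"
    by (subst sum.atMost_Suc_shift) simp
  finally show ?case
    by (simp add: sum.distrib algebra_simps del: sum.atMost_Suc funpow.simps)
qed

lemma wronskian_cong:
  assumes "\<And>j. j < g \<Longrightarrow> H j holomorphic_on uhp" "\<And>j z. j < g \<Longrightarrow> z \<in> uhp \<Longrightarrow> H j z = H' j z"
  shows "wronskian g H = wronskian g H'"
proof
  fix z
  have "H' j holomorphic_on uhp" if "j < g" for j
    using assms that holomorphic_transform by metis
  hence "(deriv ^^ i) (H j) z = (deriv ^^ i) (H' j) z" if "j < g" "z \<in> uhp" for i j
    using assms that by (intro higher_deriv_transform_within_open[OF _ _ open_uhp]) auto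
  thus "wronskian g H z = wronskian g H' z"
    unfolding wronskian_def by (auto intro!: arg_cong[of _ _ Determinant.det] eq_matI)
qed

lemma wronskian_pullback:
  assumes "\<phi> ` uhp \<subseteq> uhp" "\<psi> holomorphic_on uhp"
    and "\<And>z. z \<in> uhp \<Longrightarrow> (\<phi> has_field_derivative \<psi> z) (at z)"
    and "\<And>j. j < g \<Longrightarrow> H j holomorphic_on uhp" "z \<in> uhp"
  shows "wronskian g (\<lambda>j z. \<psi> z * H j (\<phi> z)) z = (\<Prod>i<g. \<psi> z ^ Suc i) * wronskian g H (\<phi> z)"
proof -
  have "\<phi> z \<in> uhp"
    using assms by auto
  thus ?thesis
    using assms(5) unfolding wronskian_def
    by (simp add: det_mat_lower_mult[where L = "\<lambda>i l. pullback_coeff \<psi> i l z"]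
        higher_deriv_pullback[OF open_uhp open_uhp assms(1,2,4,3)] pullback_coeff_diag)
qed

definition mobius :: "int \<Rightarrow> int \<Rightarrow> int \<Rightarrow> int \<Rightarrow> complex \<Rightarrow> complex" where
  "mobius a b c d z = (of_int a * z + of_int b) / (of_int c * z + of_int d)"

lemma mobius_denom_nonzero:
  assumes "a * d - b * c \<noteq> 0" "z \<in> uhp"
  shows "of_int c * z + of_int d \<noteq> (0 :: complex)"
proof
  assume *: "of_int c * z + of_int d = (0 :: complex)"
  hence "Im (of_int c * z + of_int d) = 0"
    by simp
  hence "c = 0"
    using assms(2) by (simp add: uhp_def)
  thus False
    using * assms(1) by simp
qed

lemma Im_mobius:
  assumes "a * d - b * c \<noteq> 0" "z \<in> uhp"
  shows "Im (mobius a b c d z) =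
    of_int (a * d - b * c) * Im z / (norm (of_int c * z + of_int d))\<^sup>2"
proof -
  have "Im (mobius a b c d z) = Im ((of_int a * z + of_int b) * cnj (of_int c * z + of_int d)) /
      (norm (of_int c * z + of_int d))\<^sup>2"
    unfolding mobius_def by (subst complex_div_cnj) (simp add: Im_divide_of_real power2_eq_square flip: of_real_power)
  thus ?thesis
    by (simp add: algebra_simps)
qed

lemma mobius_in_uhp: "a * d - b * c > 0 \<Longrightarrow> z \<in> uhp \<Longrightarrow> mobius a b c d z \<in> uhp"
  using Im_mobius[of a d b c z] mobius_denom_nonzero[of a d b c z]
  by (simp add: uhp_def del: of_int_diff of_int_mult)

lemma has_field_derivative_mobius:
  assumes "a * d - b * c = 1" "z \<in> uhp"
  shows "(mobius a b c d has_field_derivative (1 / (of_int c * z + of_int d))\<^sup>2) (at z)"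
proof -
  have nz: "of_int c * z + of_int d \<noteq> (0 :: complex)"
    using mobius_denom_nonzero[of a d b c z] assms by simp
  have det: "of_int a * of_int d - of_int b * of_int c = (1 :: complex)"
    using assms(1) by (metis of_int_1 of_int_diff of_int_mult)
  have "(mobius a b c d has_field_derivative
      (of_int a * (of_int c * z + of_int d) - (of_int a * z + of_int b) * of_int c) /
      ((of_int c * z + of_int d) * (of_int c * z + of_int d))) (at z)"
    unfolding mobius_def using nz by (auto intro!: derivative_eq_intros)
  also have "of_int a * (of_int c * z + of_int d) - (of_int a * z + of_int b) * of_int c = (1 :: complex)"
    using det by (simp add: algebra_simps)
  finally show ?thesis
    by (simp add: power2_eq_square)
qed

lemma slash_eq_mobius:
  assumes "a * d - b * c = 1"
  shows "slash (int n) a b c d f z = (1 / (of_int c * z + of_int d)) ^ n * f (mobius a b c d z)"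
  using assms by (simp add: slash_def mobius_def power_int_minus power_one_over inverse_eq_divide)

lemma prod_square_power: "(\<Prod>i<g. (u\<^sup>2) ^ Suc i) = (u :: 'a :: comm_monoid_mult) ^ (g * (g + 1))"
proof (induction g)
  case (Suc g)
  have "g * (g + 1) + 2 * Suc g = Suc g * (Suc g + 1)"
    by simp
  thus ?case
    unfolding prod.lessThan_Suc Suc.IH by (simp only: power_mult[symmetric] power_add[symmetric])
qed simp

text \<open>The weight: \<open>2 g\<close> from the entries and \<open>g (g - 1)\<close> from the derivatives.\<close>

lemma wronskian_slash:
  assumes "a * d - b * c = 1" "\<And>j. j < g \<Longrightarrow> H j holomorphic_on uhp" "z \<in> uhp"
  shows "wronskian g (\<lambda>j. slash 2 a b c d (H j)) z =
    slash (int (g * (g + 1))) a b c d (wronskian g H) z"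
proof -
  let ?\<psi> = "\<lambda>z. (1 / (of_int c * z + of_int d))\<^sup>2 :: complex"
  have "?\<psi> holomorphic_on uhp"
    using mobius_denom_nonzero[of a d b c] assms(1) by (auto intro!: holomorphic_intros)
  moreover have "mobius a b c d ` uhp \<subseteq> uhp"
    using mobius_in_uhp[of a d b c] assms(1) by auto
  moreover have "slash 2 a b c d (H j) = (\<lambda>z. ?\<psi> z * H j (mobius a b c d z))" for j
    using slash_eq_mobius[OF assms(1), of 2] by (auto simp: fun_eq_iff)
  ultimately show ?thesis
    using wronskian_pullback[of "mobius a b c d" ?\<psi> g H z]
      has_field_derivative_mobius[OF assms(1)] assms
    by (simp only: prod_square_power slash_eq_mobius[OF assms(1)])
qed

lemma norm_times_Im_slash_invariant:
  assumes "a * d - b * c > 0" "z \<in> uhp" "slash 2 a b c d f z = f z"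
  shows "norm (f (mobius a b c d z)) * Im (mobius a b c d z) = norm (f z) * Im z"
proof -
  let ?w = "of_int c * z + of_int d :: complex"
  have "slash 2 a b c d f z = of_int (a * d - b * c) / ?w\<^sup>2 * f (mobius a b c d z)"
    by (simp add: slash_def mobius_def power_int_minus divide_inverse del: of_int_diff of_int_mult)
  hence "norm (f z) = norm (of_int (a * d - b * c) / ?w\<^sup>2 * f (mobius a b c d z))"
    using assms(3) by simp
  hence "norm (f z) = of_int (a * d - b * c) / (norm ?w)\<^sup>2 * norm (f (mobius a b c d z))"
    using assms(1) unfolding norm_mult norm_divide norm_power norm_of_int
    by (simp del: of_int_diff of_int_mult)
  thus ?thesis
    using Im_mobius[of a d b c z] assms by (simp del: of_int_diff of_int_mult)
qed

section \<open>Order of vanishing at the cusp\<close>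

lemma mobius_orbit_Im_ge:
  assumes "z \<in> uhp"
  obtains a b c d where "a * d - b * c = 1" "Im (mobius a b c d z) \<ge> 2 / 5"
proof (cases "Im z \<ge> 2 / 5")
  case True
  thus ?thesis by (intro that[of 1 1 0 0]) (auto simp: mobius_def)
next
  case False
  define y where "y = Im z"
  have y: "0 < y" "y < 2 / 5"
    using assms False by (auto simp: y_def uhp_def)
  define A where "A = 1 / sqrt (2 * y)"
  have A2: "A\<^sup>2 * y = 1 / 2"
    using y by (simp add: A_def power_divide)
  have "A > 0"
    using y by (simp add: A_def)
  have "A \<ge> 1"
    using y by (simp add: A_def)
  define N where "N = nat \<lceil>A\<rceil>"
  have N: "A \<le> real N" "real N \<le> 2 * A" "N > 0"
    using \<open>A \<ge> 1\<close> unfolding N_def by linarith+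
  define t where "t = (real N)\<^sup>2 * y"
  have "A\<^sup>2 \<le> (real N)\<^sup>2" "(real N)\<^sup>2 \<le> (2 * A)\<^sup>2"
    using N \<open>A > 0\<close> by (intro power_mono; simp)+
  hence "A\<^sup>2 * y \<le> t" "t \<le> (2 * A)\<^sup>2 * y"
    using y unfolding t_def by (auto intro: mult_right_mono)
  hence t: "1 / 2 \<le> t" "t \<le> 2"
    using A2 by (auto simp: power_mult_distrib)
  obtain h k where hk: "coprime h k" "0 < k" "k \<le> int N"
    and approx: "\<bar>of_int k * Re z - of_int h\<bar> < 1 / real N"
    using Dirichlet_approx_coprime[OF N(3)] by blast
  have "(of_int k * Re z - of_int h)\<^sup>2 \<le> (1 / real N)\<^sup>2"
    using approx by (intro abs_le_square_iff[THEN iffD1]) auto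
  moreover have "(of_int k)\<^sup>2 \<le> (real N)\<^sup>2"
    using hk(2,3) by (intro power_mono) linarith+
  hence "(of_int k * y)\<^sup>2 \<le> (real N)\<^sup>2 * y\<^sup>2"
    by (simp add: power_mult_distrib mult_right_mono)
  ultimately have "(norm (of_int k * z + of_int (- h)))\<^sup>2 \<le> (1 / real N)\<^sup>2 + (real N)\<^sup>2 * y\<^sup>2"
    by (simp add: cmod_power2 y_def)
  also have "\<dots> = (1 + t\<^sup>2) / (real N)\<^sup>2"
    using N(3) by (simp add: t_def field_simps power2_eq_square)
  also have "\<dots> \<le> (5 / 2 * t) / (real N)\<^sup>2"
  proof -
    have "(t - 1 / 2) * (t - 2) \<le> 0"
      using t by (intro mult_nonneg_nonpos) auto
    moreover have "(t - 1 / 2) * (t - 2) = 1 + t\<^sup>2 - 5 / 2 * t"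
      by (simp add: field_simps power2_eq_square)
    ultimately show ?thesis
      by (intro divide_right_mono) auto
  qed
  also have "\<dots> = 5 / 2 * y"
    using N(3) by (simp add: t_def)
  finally have le: "(norm (of_int k * z + of_int (- h)))\<^sup>2 \<le> 5 / 2 * y" .
  obtain u v where "u * h + v * k = 1"
    using bezout_int[of h k] hk(1) by auto
  hence det: "(- u) * (- h) - (- v) * k = 1"
    by simp
  have "of_int k * z + of_int (- h) \<noteq> (0 :: complex)"
    using mobius_denom_nonzero[of "- u" "- h" "- v" k z] assms det by simp
  hence "2 / 5 \<le> y / (norm (of_int k * z + of_int (- h)))\<^sup>2"
    using le by (simp add: field_simps)
  hence "2 / 5 \<le> Im (mobius (- u) (- v) k (- h) z)"
    using Im_mobius[of "- u" "- h" "- v" k z] assms unfolding det y_def by simp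
  with det show ?thesis
    by (rule that)
qed

lemma S2_plus_orbit_Im_ge:
  assumes "prime p" "f \<in> S2_plus p" "z \<in> uhp"
  obtains z' where "z' \<in> uhp" "Im z' \<ge> 2 / (5 * real p)" "norm (f z') * Im z' = norm (f z) * Im z"
proof -
  have p: "p > 0"
    using assms(1) by (rule prime_gt_0_nat)
  have inv: "norm (f (mobius a b c d z)) * Im (mobius a b c d z) = norm (f z) * Im z"
    if "a * d - b * c = 1" "int p dvd c" for a b c d
    using assms that by (intro norm_times_Im_slash_invariant) (auto simp: S2_plus_def cusp_forms_def)
  obtain a b c d where abcd: "a * d - b * c = 1" "Im (mobius a b c d z) \<ge> 2 / 5"
    using mobius_orbit_Im_ge[OF assms(3)] .
  let ?z = "mobius a b c d z"
  have z: "?z \<in> uhp"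
    using mobius_in_uhp[of a d b c z] abcd assms by simp
  show ?thesis
  proof (cases "int p dvd c")
    case True
    have "2 / (5 * real p) \<le> 2 / 5"
      using p by (simp add: field_simps)
    thus ?thesis
      using that[of ?z] inv[OF abcd(1) True] abcd(2) z by simp
  next
    case False
    hence "coprime c (int p)"
      using assms(1) prime_imp_coprime[of "int p" c] by (simp add: coprime_commute)
    then obtain u v where uv: "u * c + v * int p = 1"
      using bezout_int[of c "int p"] by (metis coprime_imp_gcd_eq_1)
    define j where "j = - a * u"
    have "a + j * c = a * (1 - u * c)"
      by (simp add: j_def algebra_simps)
    also have "1 - u * c = int p * v"
      using uv by (simp add: algebra_simps)
    finally have dvd: "int p dvd a + j * c"
      by simp
    have det: "(- c) * (b + j * d) - (- d) * (a + j * c) = 1"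
      using abcd(1) by (simp add: algebra_simps)
    define z' where "z' = (?z + of_int j) / of_nat p"
    have Im': "Im z' = Im ?z / real p"
      by (simp add: z'_def)
    hence z': "z' \<in> uhp"
      using z p by (simp add: uhp_def)
    have nz: "of_int c * z + of_int d \<noteq> (0 :: complex)"
      using mobius_denom_nonzero[of a d b c z] abcd assms by simp
    have "mobius 0 (-1) (int p) 0 z' = - 1 / (?z + of_int j)"
      using p by (simp add: mobius_def z'_def)
    also have "?z + of_int j =
        (of_int (a + j * c) * z + of_int (b + j * d)) / (of_int c * z + of_int d)"
      using nz unfolding mobius_def by (simp add: field_simps)
    also have "- 1 / \<dots> = mobius (- c) (- d) (a + j * c) (b + j * d) z"
      by (simp add: mobius_def minus_divide_left)
    finally have eq: "mobius 0 (-1) (int p) 0 z' = mobius (- c) (- d) (a + j * c) (b + j * d) z" .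
    have "norm (f (mobius 0 (-1) (int p) 0 z')) * Im (mobius 0 (-1) (int p) 0 z') = norm (f z') * Im z'"
      using assms(2) p z' by (intro norm_times_Im_slash_invariant) (auto simp: S2_plus_def)
    hence "norm (f z') * Im z' = norm (f z) * Im z"
      using inv[OF det dvd] eq by simp
    moreover have "Im z' \<ge> 2 / (5 * real p)"
      using abcd(2) p by (simp add: Im' field_simps)
    ultimately show ?thesis
      using that z' by blast
  qed
qed

text \<open>
  Hecke's argument: \<open>M = sup \<bar>f(z)\<bar> Im z\<close> is already the supremum over \<open>Im z \<ge> 2 / (5 p)\<close>. The maximum
  principle for \<open>f / q^p\<close> on the disc \<open>Im z \<ge> 1 / (5 p)\<close> bounds the values there by \<open>5 / 6 M\<close>,
  so that \<open>M = 0\<close>.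
\<close>

lemma S2_plus_eq_0:
  assumes "prime p" "f \<in> S2_plus p" "has_fps_fourier 1 f F" "\<And>n. n < p \<Longrightarrow> fps_nth F n = 0" "z \<in> uhp"
  shows "f z = 0"
proof -
  have p: "p > 0"
    using assms(1) by (rule prime_gt_0_nat)
  define G where "G = fps_shift p F"
  have "F = fps_X ^ p * G"
    using assms(4) by (intro fps_ext) (auto simp: G_def fps_X_power_mult_nth)
  moreover have rF: "fps_conv_radius F \<ge> 1" and F: "\<And>z. z \<in> uhp \<Longrightarrow> f z = eval_fps F (nome 1 z)"
    using assms(3) by (auto simp: has_fps_fourier_def)
  moreover have rG: "fps_conv_radius G \<ge> 1"
    using rF by (simp add: G_def)
  ultimately have f_eq: "f z = nome 1 z ^ p * eval_fps G (nome 1 z)" if "z \<in> uhp" for z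
    using that eval_fps_mult[of "nome 1 z" "fps_X ^ p" G] nome_in_disc[of 1 G z] by simp
  have holG: "eval_fps G holomorphic_on ball 0 1"
    by (intro holomorphic_on_eval_fps) (auto intro!: less_le_trans[OF _ rG])
  define y0 where "y0 = 1 / (5 * real p)"
  have y0: "y0 > 0"
    using p by (simp add: y0_def)
  define D where "D z = norm (f z) * Im z" for z
  define r where "r y = exp (- 2 * pi * y)" for y
  have norm_q: "norm (nome 1 z) = r (Im z)" for z
    by (simp add: norm_nome r_def)
  have r: "0 < r y" "y > 0 \<Longrightarrow> r y < 1" "y \<le> y' \<Longrightarrow> r y' \<le> r y" for y y'
    by (auto simp: r_def)
  have norm_f: "norm (f z) = r (Im z) ^ p * norm (eval_fps G (nome 1 z))" if "z \<in> uhp" for z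
    by (simp only: f_eq[OF that] norm_mult norm_power norm_q)
  have red: "\<exists>z'\<in>uhp. Im z' \<ge> 2 * y0 \<and> D z' = D z" if "z \<in> uhp" for z
    using S2_plus_orbit_Im_ge[OF assms(1,2) that] by (metis D_def y0_def times_divide_eq_right mult.right_neutral)

  have sub: "cball 0 (r y0) \<subseteq> ball (0 :: complex) 1"
    using r(2)[OF y0] by auto
  have contG: "continuous_on (cball 0 (r y0)) (eval_fps G)"
    using holomorphic_on_imp_continuous_on[OF holG] sub by (rule continuous_on_subset)
  hence "bounded (eval_fps G ` cball 0 (r y0))"
    by (intro compact_imp_bounded compact_continuous_image) auto
  then obtain B where B: "\<And>w. norm w \<le> r y0 \<Longrightarrow> norm (eval_fps G w) \<le> B"
    by (metis bounded_iff imageI mem_cball_0)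
  have "D z \<le> B" if z: "z \<in> uhp" "Im z \<ge> 2 * y0" for z
  proof -
    have "Im z > 0"
      using z(1) by (simp add: uhp_def)
    have G: "norm (eval_fps G (nome 1 z)) \<le> B"
      using z(2) y0 by (intro B) (simp only: norm_q, intro r(3), linarith)
    hence B0: "B \<ge> 0"
      using norm_ge_zero order_trans by blast
    have "1 * Im z \<le> (2 * pi * real p) * Im z"
      using p pi_gt3 \<open>Im z > 0\<close> by (intro mult_right_mono) (auto intro!: mult_ge1_I[of "2 * pi" "real p", simplified])
    also have "\<dots> \<le> exp (2 * pi * real p * Im z)"
      using exp_ge_add_one_self[of "2 * pi * real p * Im z"] by linarith
    also have "\<dots> = inverse (r (Im z) ^ p)"
      by (simp add: r_def exp_minus[symmetric] exp_of_nat_mult[symmetric] mult_ac)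
    finally have "r (Im z) ^ p * Im z \<le> 1"
      using r(1)[of "Im z"] by (simp add: field_simps)
    hence "(r (Im z) ^ p * Im z) * norm (eval_fps G (nome 1 z)) \<le> 1 * B"
      using G B0 by (intro mult_mono) auto
    thus ?thesis
      unfolding D_def norm_f[OF z(1)] by (simp add: mult_ac)
  qed
  hence bdd: "D z \<le> B" if "z \<in> uhp" for z
    using red[OF that] by metis
  define M where "M = Sup (D ` uhp)"
  have DM: "D z \<le> M" if "z \<in> uhp" for z
    unfolding M_def using bdd that by (intro cSup_upper) (auto intro!: bdd_aboveI[of _ B])

  define K where "K = M / y0 / r y0 ^ p"
  have boundary: "norm (eval_fps G w) \<le> K" if w: "norm w = r y0" for w
  proof -
    have "w \<noteq> 0" "norm w < 1"
      using w r(1)[of y0] r(2)[OF y0] by auto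
    then obtain z where z: "z \<in> uhp" "nome 1 z = w"
      using nome_surj[of 1] by auto
    hence "r (Im z) = r y0"
      using w norm_q by metis
    hence "Im z = y0"
      by (simp add: r_def)
    hence "r y0 ^ p * norm (eval_fps G w) * y0 \<le> M"
      using DM[OF z(1)] z by (simp add: D_def norm_f)
    thus ?thesis
      using y0 r(1)[of y0] by (simp add: K_def field_simps)
  qed
  have max: "norm (eval_fps G w) \<le> K" if "norm w \<le> r y0" for w
  proof (rule maximum_modulus_frontier[of "eval_fps G" "cball 0 (r y0)"])
    show "eval_fps G holomorphic_on interior (cball 0 (r y0))"
      using holG interior_subset sub by (meson holomorphic_on_subset order_trans)
    show "norm (eval_fps G w) \<le> K" if "w \<in> frontier (cball 0 (r y0))" for w
      using that r(1)[of y0] by (intro boundary) (simp add: frontier_cball)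
  qed (use that contG in auto)
  have "D z \<le> 5 / 6 * M" if z: "z \<in> uhp" "Im z \<ge> 2 * y0" for z
  proof -
    have M0: "M \<ge> 0"
      using DM[OF z(1)] z(1) by (smt (verit) D_def mult_nonneg_nonneg norm_ge_zero uhp_def mem_Collect_eq)
    define x where "x = Im z / y0 - 1"
    have x: "x \<ge> 1"
      using z(2) y0 by (simp add: x_def field_simps)
    have Imz: "Im z = (1 + x) * y0"
      using y0 by (simp add: x_def)
    define E where "E = exp (2 * pi / 5 * x)"
    have "1 + x \<le> 5 / 6 * (1 + 6 / 5 * x + (6 / 5 * x)\<^sup>2 / 2)"
      using mult_ge1_I[OF x x] by (simp add: power2_eq_square field_simps)
    also have "1 + 6 / 5 * x + (6 / 5 * x)\<^sup>2 / 2 \<le> exp (6 / 5 * x)"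
      using x by (intro exp_lower_Taylor_quadratic) auto
    also have "exp (6 / 5 * x) \<le> E"
      using x pi_gt3 by (simp add: E_def)
    finally have xE: "1 + x \<le> 5 / 6 * E"
      by simp
    have "r (Im z) ^ p = r y0 ^ p / E"
    proof -
      have "real p * (2 * pi * Im z) = real p * (2 * pi * y0) + 2 * pi / 5 * x"
        using p by (simp add: Imz y0_def field_simps)
      hence "- (real p * (2 * pi * Im z)) = - (real p * (2 * pi * y0)) - 2 * pi / 5 * x"
        by simp
      thus ?thesis
        by (simp add: r_def E_def exp_of_nat_mult[symmetric] exp_diff[symmetric])
    qed
    moreover have "norm (eval_fps G (nome 1 z)) \<le> K"
      using z(2) y0 by (intro max) (simp only: norm_q, intro r(3), linarith)
    ultimately have "D z \<le> r y0 ^ p / E * K * Im z"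
      unfolding D_def norm_f[OF z(1)] using z(1) r(1)[of y0]
      by (intro mult_right_mono) (simp_all add: E_def uhp_def divide_right_mono)
    also have "\<dots> = (1 + x) / E * M"
      using y0 r(1)[of y0] by (simp add: K_def Imz)
    also have "\<dots> \<le> 5 / 6 * M"
      using xE M0 by (intro mult_right_mono) (auto simp: E_def field_simps)
    finally show ?thesis .
  qed
  hence "D z \<le> 5 / 6 * M" if "z \<in> uhp" for z
    using red[OF that] by metis
  hence "M \<le> 5 / 6 * M"
    unfolding M_def using assms(5) by (intro cSup_least) auto
  hence "D z \<le> 0"
    using DM[OF assms(5)] by linarith
  thus "f z = 0"
    using assms(5) by (simp add: D_def uhp_def mult_le_0_iff)
qed

section \<open>The normalised Wronskian\<close>

lemma comm_ring_hom_fps_nth_0: "comm_ring_hom (\<lambda>F :: complex fps. fps_nth F 0)"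
  by unfold_locales auto

lemma fps_nth_0_det:
  "fps_nth (Determinant.det (mat n n (\<lambda>(i, j). A i j))) 0 =
    Determinant.det (mat n n (\<lambda>(i, j). fps_nth (A i j :: complex fps) 0))"
  by (subst comm_ring_hom.hom_det[OF comm_ring_hom_fps_nth_0, symmetric])
     (auto intro!: arg_cong[of _ _ Determinant.det] eq_matI)

lemma has_fps_fourier_wronskian:
  assumes "h > 0" "\<And>j. j < g \<Longrightarrow> has_fps_fourier h (H j) (F j)"
  shows "has_fps_fourier h (wronskian g H) (Determinant.det (mat g g (\<lambda>(i, j).
    Abs_fps (\<lambda>n. (2 * of_real pi * \<i> / of_nat h * of_nat n) ^ i * fps_nth (F j) n))))"
proof -
  have "has_fps_fourier h (\<lambda>z. Determinant.det (mat g g (\<lambda>(i, j). (deriv ^^ i) (H j) z)))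
    (Determinant.det (mat g g (\<lambda>(i, j).
      Abs_fps (\<lambda>n. (2 * of_real pi * \<i> / of_nat h * of_nat n) ^ i * fps_nth (F j) n))))"
    using assms by (intro has_fps_fourier_det has_fps_fourier_higher_deriv) auto
  thus ?thesis
    by (simp add: has_fps_fourier_def wronskian_def)
qed

lemma cusp_formsD:
  assumes "f \<in> cusp_forms N k"
  shows "f holomorphic_on uhp"
    "a * d - b * c = 1 \<Longrightarrow> int N dvd c \<Longrightarrow> z \<in> uhp \<Longrightarrow> slash k a b c d f z = f z"
    "a * d - b * c = 1 \<Longrightarrow> \<exists>\<alpha>. has_fourier_expansion N (slash k a b c d f) \<alpha> \<and> \<alpha> 0 = 0"
  using assms by (auto simp: cusp_forms_def)

lemma wronskian_cusp_form:
  assumes "N > 0" "g > 0" and cusp: "\<And>j. j < g \<Longrightarrow> H j \<in> cusp_forms N 2"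
  shows "(\<lambda>z. s * wronskian g H z) \<in> cusp_forms N (int (g * (g + 1)))"
proof -
  let ?k = "int (g * (g + 1))"
  have hol: "H j holomorphic_on uhp" if "j < g" for j
    using cusp_formsD(1)[OF cusp[OF that]] .
  have slash_scale: "slash ?k a b c d (\<lambda>z. s * wronskian g H z) z =
      s * wronskian g (\<lambda>j. slash 2 a b c d (H j)) z"
    if "a * d - b * c = 1" "z \<in> uhp" for a b c d z
    using wronskian_slash[OF that(1) hol that(2)] by (simp add: slash_def)
  have expansion: "\<exists>\<alpha>. has_fourier_expansion N (slash ?k a b c d (\<lambda>z. s * wronskian g H z)) \<alpha> \<and> \<alpha> 0 = 0"
    if det: "a * d - b * c = 1" for a b c d
  proof -
    have "\<forall>j\<in>{..<g}. \<exists>\<alpha>. has_fourier_expansion N (slash 2 a b c d (H j)) \<alpha> \<and> \<alpha> 0 = 0"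
      using cusp_formsD(3)[OF cusp det] by auto
    then obtain \<alpha> where \<alpha>: "\<And>j. j < g \<Longrightarrow> has_fourier_expansion N (slash 2 a b c d (H j)) (\<alpha> j)"
      "\<And>j. j < g \<Longrightarrow> \<alpha> j 0 = 0"
      by (metis (no_types, lifting) bchoice lessThan_iff)
    define A where "A = Determinant.det (mat g g (\<lambda>(i, j).
      Abs_fps (\<lambda>n. (2 * of_real pi * \<i> / of_nat N * of_nat n) ^ i * fps_nth (Abs_fps (\<alpha> j)) n)))"
    have "has_fps_fourier N (wronskian g (\<lambda>j. slash 2 a b c d (H j))) A"
      unfolding A_def using \<alpha>(1) assms(1)
      by (intro has_fps_fourier_wronskian) (auto simp: has_fourier_expansion_iff)
    hence "has_fps_fourier N (\<lambda>z. s * wronskian g (\<lambda>j. slash 2 a b c d (H j)) z) (fps_const s * A)"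
      using assms(1) by (intro has_fps_fourier_cmult)
    hence "has_fps_fourier N (slash ?k a b c d (\<lambda>z. s * wronskian g H z)) (fps_const s * A)"
      using slash_scale[OF det] by (simp add: has_fps_fourier_def)
    moreover have "fps_nth A 0 = Determinant.det (mat g g (\<lambda>(i, j). 0))"
      unfolding A_def fps_nth_0_det using \<alpha>(2)
      by (intro arg_cong[of _ _ Determinant.det] eq_matI) auto
    hence "fps_nth A 0 = 0"
      using assms(2) by (simp add: det_mat_eq_sum power_0_left)
    ultimately show ?thesis
      using assms(1) by (intro exI[of _ "fps_nth (fps_const s * A)"])
        (simp add: has_fourier_expansion_iff fps_nth_inverse)
  qed
  have "(\<lambda>z. s * wronskian g H z) holomorphic_on uhp"
  proof -
    have "(\<lambda>z. s * Determinant.det (mat g g (\<lambda>(i, j). (deriv ^^ i) (H j) z))) holomorphic_on uhp"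
      unfolding det_mat_eq_sum using hol open_uhp
      by (intro holomorphic_intros holomorphic_higher_deriv) (auto dest: permutes_in_image)
    thus ?thesis
      by (rule holomorphic_transform) (simp add: wronskian_def)
  qed
  moreover have "slash ?k a b c d (\<lambda>z. s * wronskian g H z) z = s * wronskian g H z"
    if "a * d - b * c = 1" "int N dvd c" "z \<in> uhp" for a b c d z
  proof -
    have "wronskian g H = wronskian g (\<lambda>j. slash 2 a b c d (H j))"
      using hol cusp_formsD(2)[OF cusp that(1,2)] by (intro wronskian_cong) auto
    thus ?thesis
      using slash_scale[OF that(1,3)] by simp
  qed
  moreover have "s * wronskian g H z = 0" if "z \<notin> uhp" for z
    using that by (simp add: wronskian_def)
  ultimately show ?thesis
    using expansion by (simp add: cusp_forms_def)
qed

lemma higher_deriv_sum: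
  assumes "open S" "z \<in> S" "\<And>k. k \<in> A \<Longrightarrow> f k holomorphic_on S"
  shows "(deriv ^^ n) (\<lambda>z. \<Sum>k\<in>A. f k z) z = (\<Sum>k\<in>A. (deriv ^^ n) (f k) z)"
  using assms(3)
proof (induction A rule: infinite_finite_induct)
  case (insert k A)
  thus ?case
    using assms(1,2) by (simp add: higher_deriv_add[of _ S] holomorphic_on_sum)
qed auto

lemma wronskian_linear_combination:
  assumes "\<And>k. k < g \<Longrightarrow> f k holomorphic_on uhp"
    and "\<And>j. j < g \<Longrightarrow> H j = (\<lambda>z. \<Sum>k<g. A k j * f k z)"
  shows "wronskian g H z = Determinant.det (mat g g (\<lambda>(k, j). A k j)) * wronskian g f z"
proof (cases "z \<in> uhp")
  case True
  let ?F = "mat g g (\<lambda>(i, j). (deriv ^^ i) (f j) z)" and ?A = "mat g g (\<lambda>(k, j). A k j)"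
  have "(deriv ^^ i) (H j) z = (\<Sum>k<g. (deriv ^^ i) (f k) z * A k j)" if "j < g" for i j
  proof -
    have "(deriv ^^ i) (H j) z = (\<Sum>k<g. (deriv ^^ i) (\<lambda>z. A k j * f k z) z)"
      using assms that True open_uhp
      by (simp only: assms(2)[OF that], intro higher_deriv_sum) (auto intro!: holomorphic_intros)
    also have "\<dots> = (\<Sum>k<g. (deriv ^^ i) (f k) z * A k j)"
      using assms(1) True open_uhp
      by (intro sum.cong refl) (simp add: higher_deriv_cmult[of _ uhp])
    finally show ?thesis .
  qed
  hence "mat g g (\<lambda>(i, j). (deriv ^^ i) (H j) z) = ?F * ?A"
    by (intro eq_matI) (auto simp: scalar_prod_def lessThan_atLeast0)
  thus ?thesis
    using True by (simp add: wronskian_def det_mult[of _ g])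
qed (simp add: wronskian_def)

lemma sum_fun_apply: "(\<Sum>x\<in>A. f x) z = (\<Sum>x\<in>A. f x z)"
  by (induction A rule: infinite_finite_induct) auto

lemma basis_S2_plusD:
  assumes "is_basis_S2_plus p f" "j < genus_X0_plus p"
  shows "f j \<in> S2_plus p"
  using assms cfun.span_base[of "f j" "f ` {..<genus_X0_plus p}"]
  by (auto simp: is_basis_S2_plus_def Let_def)

lemma wronskian_change_of_basis:
  assumes "is_basis_S2_plus p f" "is_basis_S2_plus p H" "g = genus_X0_plus p"
  obtains t where "wronskian g H = (\<lambda>z. t * wronskian g f z)"
proof -
  have "\<exists>A. \<forall>z. H j z = (\<Sum>k<g. A k * f k z)" if "j < g" for j
  proof -
    have "H j \<in> cfun.span (f ` {..<g})"
      using basis_S2_plusD[OF assms(2)] assms that by (simp add: is_basis_S2_plus_def Let_def)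
    then obtain u where "H j = (\<Sum>v\<in>f ` {..<g}. (\<lambda>z. u v * v z))"
      by (auto simp: cfun.span_finite)
    also have "\<dots> = (\<Sum>k<g. (\<lambda>z. u (f k) * f k z))"
      using assms by (subst sum.reindex) (auto simp: is_basis_S2_plus_def Let_def)
    finally show ?thesis
      by (intro exI[of _ "\<lambda>k. u (f k)"]) (simp add: sum_fun_apply)
  qed
  then obtain A where "\<And>j z. j < g \<Longrightarrow> H j z = (\<Sum>k<g. A j k * f k z)"
    by metis
  hence A: "\<And>j. j < g \<Longrightarrow> H j = (\<lambda>z. \<Sum>k<g. A j k * f k z)"
    by blast
  have "f k holomorphic_on uhp" if "k < g" for k
    using basis_S2_plusD[OF assms(1)] that assms(3) by (auto simp: S2_plus_def cusp_forms_def)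
  hence "wronskian g H z = Determinant.det (mat g g (\<lambda>(k, j). A j k)) * wronskian g f z" for z
    using A by (rule wronskian_linear_combination)
  thus thesis
    using that by blast
qed

lemma fps_nth_det_theta:
  fixes F :: "nat \<Rightarrow> complex fps"
  assumes "\<And>j n. j < g \<Longrightarrow> n < c j \<Longrightarrow> fps_nth (F j) n = 0" "\<And>j. j < g \<Longrightarrow> fps_nth (F j) (c j) = 1"
  defines "W \<equiv> Determinant.det (mat g g (\<lambda>(i, j). Abs_fps (\<lambda>n. of_nat n ^ i * fps_nth (F j) n)))"
  shows "n < (\<Sum>j<g. c j) \<Longrightarrow> fps_nth W n = 0"
    and "fps_nth W (\<Sum>j<g. c j) = (\<Prod>i<g. \<Prod>l<i. of_nat (c i) - of_nat (c l))"
proof -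
  define K where "K i j = Abs_fps (\<lambda>n. of_nat (n + c j) ^ i * fps_nth (F j) (n + c j))" for i j
  have "Abs_fps (\<lambda>n. of_nat n ^ i * fps_nth (F j) n) = K i j * fps_X ^ c j" if "j < g" for i j
    using assms(1)[OF that] by (intro fps_ext) (simp add: K_def fps_X_power_mult_right_nth)
  hence "W = Determinant.det (mat g g (\<lambda>(i, j). K i j * fps_X ^ c j))"
    unfolding W_def by (intro arg_cong[of _ _ Determinant.det] eq_matI) auto
  also have "\<dots> = fps_X ^ (\<Sum>j<g. c j) * Determinant.det (mat g g (\<lambda>(i, j). K i j))"
    by (simp add: det_mat_col_scale power_sum)
  finally have W: "W = fps_X ^ (\<Sum>j<g. c j) * Determinant.det (mat g g (\<lambda>(i, j). K i j))" .
  show "n < (\<Sum>j<g. c j) \<Longrightarrow> fps_nth W n = 0"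
    by (simp add: W fps_X_power_mult_nth)
  have "fps_nth W (\<Sum>j<g. c j) = Determinant.det (mat g g (\<lambda>(i, j). fps_nth (K i j) 0))"
    by (simp add: W fps_X_power_mult_nth fps_nth_0_det)
  also have "\<dots> = Determinant.det (mat g g (\<lambda>(i, j). of_nat (c j) ^ i))"
    using assms(2) by (intro arg_cong[of _ _ Determinant.det] eq_matI) (auto simp: K_def)
  finally show "fps_nth W (\<Sum>j<g. c j) = (\<Prod>i<g. \<Prod>l<i. of_nat (c i) - of_nat (c l))"
    by (simp add: det_Vandermonde)
qed

theorem theorem5p1:
  fixes p g :: nat
  assumes "prime p"
    and "g = genus_X0_plus p"
    and "g \<ge> 2"
    and "has_good_basis p"
  shows "normalized_wronskian p \<in> cusp_forms p (int (g * (g + 1))) \<and>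
    (\<exists>\<alpha>. has_q_expansion (normalized_wronskian p) \<alpha> \<and> (\<forall>n. p_integral p (\<alpha> n)))"
proof -
  have p: "p > 0"
    using assms(1) by (rule prime_gt_0_nat)
  have g: "g - 1 < g"
    using assms(3) by simp
  obtain c f \<alpha> where "is_reduced_basis p c f \<alpha>" and integral: "\<And>i n. i < g \<Longrightarrow> p_integral p (\<alpha> i n)"
    using assms(2,4) by (auto simp: has_good_basis_def)
  hence basis: "is_basis_S2_plus p f" and mono: "strict_mono_on {..<g} c"
    and expansion: "\<And>i. i < g \<Longrightarrow> has_q_expansion (f i) (\<alpha> i)"
    and echelon: "\<And>i n. i < g \<Longrightarrow> n \<le> c (g - 1) \<Longrightarrow> \<alpha> i n = (if n = c i then 1 else 0)"
    using assms(2) by (auto simp: is_reduced_basis_def Let_def)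
  define F where "F i = Abs_fps (\<alpha> i)" for i
  have F: "has_fps_fourier 1 (f i) (F i)" if "i < g" for i
    using expansion[OF that] by (simp add: F_def has_fourier_expansion_iff)
  have c_le: "c i \<le> c (g - 1)" if "i < g" for i
    using strict_mono_on_leD[OF mono, of i "g - 1"] that by auto
  have F_lead: "fps_nth (F i) (c i) = 1" and F_zero: "n < c i \<Longrightarrow> fps_nth (F i) n = 0" if "i < g" for i n
    using echelon[OF that] c_le[OF that] by (auto simp: F_def)

  have "c (g - 1) < p"
  proof (rule ccontr)
    assume "\<not> c (g - 1) < p"
    hence vanish: "fps_nth (F (g - 1)) n = 0" if "n < p" for n
      using that g by (intro F_zero) auto
    have "f (g - 1) \<in> S2_plus p"
      using basis_S2_plusD[OF basis] g assms(2) by simp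
    hence "f (g - 1) z = 0" if "z \<in> uhp" for z
      using F[OF g] vanish that by (rule S2_plus_eq_0[OF assms(1)])
    hence "has_fps_fourier 1 (f (g - 1)) 0"
      by (simp add: has_fps_fourier_def)
    hence "F (g - 1) = 0"
      using F[OF g] by (intro has_fps_fourier_unique[of 1]) auto
    thus False
      using F_lead[OF g] by simp
  qed
  define V where "V = (\<Prod>i<g. \<Prod>l<i. int (c i) - int (c l))"
  have "\<not> int p dvd int (c i) - int (c l)" if "i < g" "l < i" for i l
  proof -
    have "c l < c i"
      using strict_mono_onD[OF mono, of l i] that by auto
    moreover have "c i < p"
      using c_le[OF that(1)] \<open>c (g - 1) < p\<close> by simp
    ultimately show ?thesis
      by (intro zdvd_not_zless) auto
  qed
  hence V: "\<not> int p dvd V"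
    using assms(1) by (simp add: V_def prime_dvd_prod_iff)
  hence V0: "(of_int V :: complex) \<noteq> 0"
    by auto

  define \<Theta> where "\<Theta> = Determinant.det (mat g g (\<lambda>(i, j). Abs_fps (\<lambda>n. of_nat n ^ i * fps_nth (F j) n)))"
  define n0 where "n0 = (\<Sum>j<g. c j)"
  have \<Theta>_zero: "fps_nth \<Theta> n = 0" if "n < n0" for n
    using fps_nth_det_theta(1)[of g c F n] F_zero F_lead that by (simp add: \<Theta>_def n0_def)
  have \<Theta>_lead: "fps_nth \<Theta> n0 = of_int V"
    using fps_nth_det_theta(2)[of g c F] F_zero F_lead by (simp add: \<Theta>_def n0_def V_def)
  have \<Theta>_integral: "p_integral p (fps_nth \<Theta> n)" for n
  proof -
    have "p_integral p (of_nat m ^ i * fps_nth (F j) m)" if "j < g" for i j m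
      using p_integral_of_int[OF assms(1), of "int m ^ i"] integral[OF that]
      by (auto simp: F_def intro!: p_integral_mult assms(1))
    thus ?thesis
      unfolding \<Theta>_def by (intro p_integral_fps_det assms(1)) auto
  qed

  define C where "C = (\<Prod>i<g. (2 * of_real pi * \<i> :: complex) ^ i)"
  have C0: "C \<noteq> 0"
    by (simp add: C_def)
  define W where "W = (\<lambda>z. 1 / (C * of_int V) * wronskian g f z)"
  define E where "E = fps_const (1 / of_int V) * \<Theta>"
  have W: "has_fps_fourier 1 W E"
  proof -
    let ?L = "\<lambda>i l. if l = i then fps_const ((2 * of_real pi * \<i>) ^ i) else (0 :: complex fps)"
    have "Determinant.det (mat g g (\<lambda>(i, j).
        Abs_fps (\<lambda>n. (2 * of_real pi * \<i> / of_nat 1 * of_nat n) ^ i * fps_nth (F j) n))) =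
        (\<Prod>i<g. ?L i i) * \<Theta>"
      unfolding \<Theta>_def
      by (rule det_mat_lower_mult) (auto intro!: fps_ext simp: if_distrib[of "\<lambda>x. x * _"] power_mult_distrib cong: if_cong)
    also have "(\<Prod>i<g. ?L i i) = fps_const C"
      unfolding C_def by (induction g) auto
    finally have "has_fps_fourier 1 (wronskian g f) (fps_const C * \<Theta>)"
      using has_fps_fourier_wronskian[of 1 g f F] F by simp
    hence "has_fps_fourier 1 W (fps_const (1 / (C * of_int V)) * (fps_const C * \<Theta>))"
      unfolding W_def by (intro has_fps_fourier_cmult) auto
    thus ?thesis
      using C0 by (simp add: E_def mult.assoc[symmetric])
  qed
  have E_lead: "fps_nth E n0 = 1" and E_zero: "n < n0 \<Longrightarrow> fps_nth E n = 0" for n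
    using \<Theta>_lead \<Theta>_zero V0 by (auto simp: E_def)

  have "normalized_wronskian p = W"
    unfolding normalized_wronskian_def assms(2)[symmetric]
  proof (rule the_equality)
    have "has_q_expansion W (fps_nth E)"
      using W by (simp add: has_fourier_expansion_iff fps_nth_inverse)
    thus "has_leading_coeff_1 W \<and> (\<exists>H s. is_basis_S2_plus p H \<and> W = (\<lambda>z. s * wronskian g H z))"
      using basis E_lead E_zero unfolding W_def has_leading_coeff_1_def by blast
  next
    fix W' assume "has_leading_coeff_1 W' \<and> (\<exists>H s. is_basis_S2_plus p H \<and> W' = (\<lambda>z. s * wronskian g H z))"
    then obtain H s \<beta> n where W': "is_basis_S2_plus p H" "W' = (\<lambda>z. s * wronskian g H z)"
      "has_q_expansion W' \<beta>" "\<beta> n = 1" "\<And>m. m < n \<Longrightarrow> \<beta> m = 0"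
      by (auto simp: has_leading_coeff_1_def)
    obtain t where t: "wronskian g H = (\<lambda>z. t * wronskian g f z)"
      using wronskian_change_of_basis[OF basis W'(1) assms(2)] .
    define u where "u = s * t * C * of_int V"
    have u: "W' = (\<lambda>z. u * W z)"
      using C0 V0 by (auto simp: W'(2) t u_def W_def fun_eq_iff)
    have "has_fps_fourier 1 W' (fps_const u * E)"
      unfolding u using W by (intro has_fps_fourier_cmult) auto
    moreover have "has_fps_fourier 1 W' (Abs_fps \<beta>)"
      using W'(3) by (simp add: has_fourier_expansion_iff)
    ultimately have "Abs_fps \<beta> = fps_const u * E"
      by (intro has_fps_fourier_unique[of 1]) auto
    hence \<beta>: "\<beta> m = u * fps_nth E m" for m
      by (metis fps_mult_left_const_nth fps_nth_Abs_fps)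
    have "\<not> n < n0" "\<not> n0 < n"
      using \<beta>[of n] \<beta>[of n0] W'(4) W'(5)[of n0] E_zero[of n] E_lead by auto
    hence "u = 1"
      using \<beta>[of n] W'(4) E_lead by (simp add: not_less le_antisym)
    thus "W' = W"
      using u by simp
  qed
  moreover have "W \<in> cusp_forms p (int (g * (g + 1)))"
    unfolding W_def using p assms(2,3) basis_S2_plusD[OF basis]
    by (intro wronskian_cusp_form) (auto simp: S2_plus_def)
  moreover have "has_q_expansion W (fps_nth E)"
    using W by (simp add: has_fourier_expansion_iff fps_nth_inverse)
  moreover have "p_integral p (fps_nth E n)" for n
  proof -
    have "p_integral p (1 / of_int V)"
      unfolding p_integral_def using V by (metis of_int_1)
    thus ?thesis
      using \<Theta>_integral by (simp only: E_def fps_mult_left_const_nth) (rule p_integral_mult[OF assms(1)])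
  qed
  ultimately show ?thesis
    by auto
qed

end
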